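(* Let $\mu$ be a non-trivial probability measure on the unit sphere $\partial\mathbb{B}^d\subset\mathbb{C}^d$. The Christoffel function $\lambda_\infty^{(d)}(z;d\mu)=\lim_{n\to\infty}\lambda_n^{(d)}(z;d\mu)$ of $\mu$ exists for all $z\in\mathbb{C}^d$ and is given by $$\lambda_\infty^{(d)}(z;d\mu)=\inf\left\{\int_{\partial\mathbb{B}^d}|q(\zeta)|^2\,d\mu(\zeta):\ q\in\mathbb{C}[z_1,\dots,z_d],\ q(z)=1\right\}.$$
   Context: The shortlex order $\prec$ on $\mathbb{N}_0^d$: $\alpha\prec\beta$ if $|\alpha|<|\beta|$ (where $|\alpha|=\alpha_1+\dots+\alpha_d$), or if $|\alpha|=|\beta|$ and $\alpha_i>\beta_i$ at the first index $i$ where they differ. $\alpha(n)=(0,\dots,0,n)$ is the last multi-index of length $n$. A positive measure $\mu$ on $\partial\mathbb{B}^d$ is non-trivial if the matrix $[\int\zeta^{\alpha'}\overline{\zeta}^{\beta'}d\mu]_{0\preceq\alpha',\beta'\preceq\alpha}$ is invertible for every $\alpha\in\mathbb{N}_0^d$. The orthonormal polynomials $(\varphi_\alpha)_{\alpha\in\mathbb{N}_0^d}$ of $\mu$ are obtained by Gram--Schmidt, with respect to $\langle p,q\rangle_\mu=\int_{\partial\mathbb{B}^d}p\overline{q}\,d\mu$, applied to the monomials $z^\alpha$ in shortlex order. The Christoffel approximates are $$\lambda_n^{(d)}(z;d\mu)=\Big(\sum_{0\preceq\alpha\preceq\alpha(n)}|\varphi_\alpha(z)|^2\Big)^{-1}.$$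 *)

theory Defs
  imports "HOL-Analysis.Analysis" "HOL-Probability.Probability" "HOL-Library.Poly_Mapping"
begin

text \<open>
  The dimension is the size of a finite index type \<open>'d\<close>; its linear order is the order
  of the coordinates.  Multi-indices are elements of \<open>nat ^ 'd\<close>.
\<close>

definition mlength :: "nat ^ 'd \<Rightarrow> nat" where
  "mlength \<alpha> = (\<Sum>i\<in>UNIV. \<alpha> $ i)"

definition shortlex_less ::
    "nat ^ 'd::{finite,linorder} \<Rightarrow> nat ^ 'd::{finite,linorder} \<Rightarrow> bool" (infix "\<prec>\<^sub>s" 50) where
  "\<alpha> \<prec>\<^sub>s \<beta> \<longleftrightarrow> mlength \<alpha> < mlength \<beta> \<or>
     mlength \<alpha> = mlength \<beta> \<and> (\<exists>i. \<alpha> $ i > \<beta> $ i \<and> (\<forall>j<i. \<alpha> $ j = \<beta> $ j))"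

definition shortlex_le ::
    "nat ^ 'd::{finite,linorder} \<Rightarrow> nat ^ 'd::{finite,linorder} \<Rightarrow> bool" (infix "\<preceq>\<^sub>s" 50) where
  "\<alpha> \<preceq>\<^sub>s \<beta> \<longleftrightarrow> \<alpha> \<prec>\<^sub>s \<beta> \<or> \<alpha> = \<beta>"

definition last_index :: "nat \<Rightarrow> nat ^ 'd::{finite,linorder}" where
  "last_index n = (\<chi> i. if i = Max UNIV then n else 0)"

lemma shortlex_less_irrefl: "\<not> \<alpha> \<prec>\<^sub>s \<alpha>"
  by (auto simp: shortlex_less_def)

lemma shortlex_less_trans:
  assumes "\<alpha> \<prec>\<^sub>s \<beta>" "\<beta> \<prec>\<^sub>s \<gamma>"
  shows "\<alpha> \<prec>\<^sub>s \<gamma>"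
proof -
  consider "mlength \<alpha> < mlength \<gamma>"
    | "mlength \<alpha> = mlength \<beta>" "mlength \<beta> = mlength \<gamma>"
    using assms by (fastforce simp: shortlex_less_def)
  then show ?thesis
  proof cases
    case 1
    then show ?thesis by (simp add: shortlex_less_def)
  next
    case 2
    then obtain i j where
      i: "\<alpha> $ i > \<beta> $ i" "\<And>k. k < i \<Longrightarrow> \<alpha> $ k = \<beta> $ k" and
      j: "\<beta> $ j > \<gamma> $ j" "\<And>k. k < j \<Longrightarrow> \<beta> $ k = \<gamma> $ k"
      using assms by (auto simp: shortlex_less_def)
    have "\<alpha> $ min i j > \<gamma> $ min i j"
      using i j by (cases i j rule: linorder_cases) (auto simp: min_def)
    moreover have "\<alpha> $ k = \<gamma> $ k" if "k < min i j" for k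
      using that i j by auto
    ultimately show ?thesis
      using 2 by (auto simp: shortlex_less_def)
  qed
qed

lemma finite_mlength_le: "finite {\<alpha> :: nat ^ 'd::finite. mlength \<alpha> \<le> N}"
proof (rule finite_subset)
  show "{\<alpha> :: nat ^ 'd. mlength \<alpha> \<le> N} \<subseteq> vec_lambda ` (UNIV \<rightarrow>\<^sub>E {..N})"
  proof
    fix \<alpha> :: "nat ^ 'd" assume "\<alpha> \<in> {\<alpha>. mlength \<alpha> \<le> N}"
    then have "\<alpha> $ i \<le> N" for i
      using member_le_sum[of i UNIV "\<lambda>i. \<alpha> $ i"] by (auto simp: mlength_def)
    then have "vec_nth \<alpha> \<in> UNIV \<rightarrow>\<^sub>E {..N}" by auto
    then show "\<alpha> \<in> vec_lambda ` (UNIV \<rightarrow>\<^sub>E {..N})"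
      by (intro image_eqI[of _ _ "vec_nth \<alpha>"]) auto
  qed
qed (intro finite_imageI finite_PiE; simp)

lemma finite_shortlex_less: "finite {\<beta>. \<beta> \<prec>\<^sub>s \<alpha>}"
  by (rule finite_subset[OF _ finite_mlength_le[of "mlength \<alpha>"]]) (auto simp: shortlex_less_def)

lemma wf_shortlex: "wf {(\<beta>, \<alpha> :: nat ^ 'd::{finite,linorder}). \<beta> \<prec>\<^sub>s \<alpha>}"
proof (rule wf_subset)
  show "wf (Wellfounded.measure (\<lambda>\<alpha> :: nat ^ 'd::{finite,linorder}. card {\<beta>. \<beta> \<prec>\<^sub>s \<alpha>}))" by simp
  have "card {\<gamma>. \<gamma> \<prec>\<^sub>s \<beta>} < card {\<gamma>. \<gamma> \<prec>\<^sub>s \<alpha>}" if "\<beta> \<prec>\<^sub>s \<alpha>" for \<alpha> \<beta> :: "nat ^ 'd::{finite,linorder}"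
    by (rule psubset_card_mono[OF finite_shortlex_less])
       (use that shortlex_less_trans shortlex_less_irrefl in blast)
  then show "{(\<beta>, \<alpha> :: nat ^ 'd::{finite,linorder}). \<beta> \<prec>\<^sub>s \<alpha>} \<subseteq> Wellfounded.measure (\<lambda>\<alpha>. card {\<beta>. \<beta> \<prec>\<^sub>s \<alpha>})" by auto
qed

text \<open>
  The polynomial ring in \<open>d\<close> variables is the monoid algebra of the additive monoid \<open>nat ^ 'd\<close>:
  \<open>Poly_Mapping.lookup p \<alpha>\<close> is the coefficient of the monomial with exponent \<open>\<alpha>\<close>.
\<close>

type_synonym 'd cpoly = "(nat ^ 'd) \<Rightarrow>\<^sub>0 complex"

definition monom_eval :: "nat ^ 'd \<Rightarrow> complex ^ 'd \<Rightarrow> complex" where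
  "monom_eval \<alpha> z = (\<Prod>i\<in>UNIV. (z $ i) ^ (\<alpha> $ i))"

definition poly_eval :: "'d cpoly \<Rightarrow> complex ^ 'd \<Rightarrow> complex" where
  "poly_eval p z = (\<Sum>\<alpha>\<in>Poly_Mapping.keys p. Poly_Mapping.lookup p \<alpha> * monom_eval \<alpha> z)"

abbreviation mono_poly :: "nat ^ 'd \<Rightarrow> 'd cpoly" where
  "mono_poly \<alpha> \<equiv> Poly_Mapping.single \<alpha> 1"

abbreviation smult_poly :: "complex \<Rightarrow> 'd cpoly \<Rightarrow> 'd cpoly" where
  "smult_poly c p \<equiv> Poly_Mapping.map ((*) c) p"

text \<open>
  The Gram matrices below are indexed by finite sets of multi-indices, so invertibility is
  stated for an arbitrary finite index set rather than for an index type.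
\<close>

definition invertible_on ::
    "'i set \<Rightarrow> ('i \<Rightarrow> 'i \<Rightarrow> complex) \<Rightarrow> bool" where
  "invertible_on I A \<longleftrightarrow> (\<exists>B. \<forall>i\<in>I. \<forall>j\<in>I.
     (\<Sum>k\<in>I. A i k * B k j) = (if i = j then 1 else 0) \<and>
     (\<Sum>k\<in>I. B i k * A k j) = (if i = j then 1 else 0))"

definition nontrivial :: "(complex ^ 'd::{finite,linorder}) measure \<Rightarrow> bool" where
  "nontrivial \<mu> \<longleftrightarrow> (\<forall>\<alpha>. invertible_on {\<beta>. 0 \<preceq>\<^sub>s \<beta> \<and> \<beta> \<preceq>\<^sub>s \<alpha>}
     (\<lambda>\<alpha>' \<beta>'. LINT \<zeta>|\<mu>. monom_eval \<alpha>' \<zeta> * cnj (monom_eval \<beta>' \<zeta>)))"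

definition poly_inner ::
    "(complex ^ 'd) measure \<Rightarrow> 'd cpoly \<Rightarrow> 'd cpoly \<Rightarrow> complex" where
  "poly_inner \<mu> p q = (LINT \<zeta>|\<mu>. poly_eval p \<zeta> * cnj (poly_eval q \<zeta>))"

definition poly_norm :: "(complex ^ 'd) measure \<Rightarrow> 'd cpoly \<Rightarrow> real" where
  "poly_norm \<mu> p = sqrt (LINT \<zeta>|\<mu>. (cmod (poly_eval p \<zeta>))\<^sup>2)"

text \<open>
  Gram--Schmidt on the monomials, in the form that orthogonalizes first and normalizes
  afterwards.  The denominators are positive when \<open>\<mu>\<close> is non-trivial; otherwise they may
  vanish.
\<close>

function orthog_poly ::
    "(complex ^ 'd::{finite,linorder}) measure \<Rightarrow> nat ^ 'd::{finite,linorder} \<Rightarrow> 'd cpoly" where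
  "orthog_poly \<mu> \<alpha> = mono_poly \<alpha> -
     (\<Sum>\<beta>\<in>{\<beta>. \<beta> \<prec>\<^sub>s \<alpha>}. smult_poly
        (poly_inner \<mu> (mono_poly \<alpha>) (orthog_poly \<mu> \<beta>)
          / poly_inner \<mu> (orthog_poly \<mu> \<beta>) (orthog_poly \<mu> \<beta>))
        (orthog_poly \<mu> \<beta>))"
  by auto
termination
  by (relation "inv_image {(\<beta>, \<alpha>). \<beta> \<prec>\<^sub>s \<alpha>} snd") (auto intro: wf_inv_image wf_shortlex)

declare orthog_poly.simps [simp del]

definition orthon_poly ::
    "(complex ^ 'd::{finite,linorder}) measure \<Rightarrow> nat ^ 'd::{finite,linorder} \<Rightarrow> 'd cpoly" where
  "orthon_poly \<mu> \<alpha> =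
     smult_poly (complex_of_real (1 / poly_norm \<mu> (orthog_poly \<mu> \<alpha>))) (orthog_poly \<mu> \<alpha>)"

definition christoffel_approx ::
    "nat \<Rightarrow> (complex ^ 'd::{finite,linorder}) measure \<Rightarrow> complex ^ 'd::{finite,linorder} \<Rightarrow> real" where
  "christoffel_approx n \<mu> z =
     inverse (\<Sum>\<alpha> | 0 \<preceq>\<^sub>s \<alpha> \<and> \<alpha> \<preceq>\<^sub>s last_index n. (cmod (poly_eval (orthon_poly \<mu> \<alpha>) z))\<^sup>2)"

definition christoffel ::
    "(complex ^ 'd::{finite,linorder}) measure \<Rightarrow> complex ^ 'd::{finite,linorder} \<Rightarrow> real" where
  "christoffel \<mu> z = lim (\<lambda>n. christoffel_approx n \<mu> z)"

end

theory Submission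
  imports Defs
begin

text \<open>
  Let \<open>V\<^sub>n\<close> be the space of polynomials whose exponents are at most \<open>last_index n\<close>.
  The orthonormal polynomials with these indices form an orthonormal basis of \<open>V\<^sub>n\<close>,
  so evaluation at \<open>z\<close> is a linear functional on \<open>V\<^sub>n\<close> of squared norm
  \<open>K\<^sub>n(z) = \<Sum>\<bar>\<phi>\<^sub>\<alpha>(z)\<bar>\<^sup>2\<close>.  By Cauchy--Schwarz, \<open>q(z) = 1\<close> with \<open>q\<close> in \<open>V\<^sub>n\<close>
  forces \<open>\<parallel>q\<parallel>\<^sup>2 \<ge> 1 / K\<^sub>n(z)\<close> (\<open>christoffel_approx_le\<close>), and the multiple of the
  reproducing kernel that takes the value \<open>1\<close> at \<open>z\<close> gives equality
  (\<open>christoffel_approx_attained\<close>).  Hence \<open>1 / K\<^sub>n(z)\<close> is the minimum of the extremal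
  problem over \<open>V\<^sub>n\<close>.  The spaces \<open>V\<^sub>n\<close> increase and exhaust all polynomials, so these
  minima decrease to the infimum over all polynomials.

  Non-triviality of the measure enters in one place only: it makes the \<open>L\<^sup>2\<close> seminorm
  definite on polynomials (\<open>poly_norm_eq_0_iff\<close>), so that Gram--Schmidt never divides by
  zero.
\<close>

section \<open>The shortlex order\<close>

lemma zero_shortlex_le: "0 \<preceq>\<^sub>s \<alpha>"
  by (cases "\<alpha> = 0")
     (auto simp: shortlex_le_def shortlex_less_def mlength_def vec_eq_iff)

lemma mlength_last_index: "mlength (last_index n) = n"
  by (simp add: mlength_def last_index_def)

lemma finite_shortlex_le: "finite {\<beta>. \<beta> \<preceq>\<^sub>s \<alpha>}"
proof -
  have "{\<beta>. \<beta> \<preceq>\<^sub>s \<alpha>} = insert \<alpha> {\<beta>. \<beta> \<prec>\<^sub>s \<alpha>}"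
    by (auto simp: shortlex_le_def)
  then show ?thesis
    by (simp add: finite_shortlex_less)
qed

lemma shortlex_le_less_trans: "\<alpha> \<preceq>\<^sub>s \<beta> \<Longrightarrow> \<beta> \<prec>\<^sub>s \<gamma> \<Longrightarrow> \<alpha> \<prec>\<^sub>s \<gamma>"
  by (auto simp: shortlex_le_def intro: shortlex_less_trans)

text \<open>Indices of equal length are compared at the first coordinate in which the indices differ.\<close>

lemma shortlex_linear:
  assumes "\<alpha> \<noteq> \<beta>"
  shows "\<alpha> \<prec>\<^sub>s \<beta> \<or> \<beta> \<prec>\<^sub>s \<alpha>"
proof -
  define i where "i = Min {j. \<alpha> $ j \<noteq> \<beta> $ j}"
  have "{j. \<alpha> $ j \<noteq> \<beta> $ j} \<noteq> {}"
    using assms by (auto simp: vec_eq_iff)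
  then have i: "\<alpha> $ i \<noteq> \<beta> $ i"
    using Min_in[of "{j. \<alpha> $ j \<noteq> \<beta> $ j}"] by (simp add: i_def)
  have "\<alpha> $ j = \<beta> $ j" if "j < i" for j
  proof (rule ccontr)
    assume "\<alpha> $ j \<noteq> \<beta> $ j"
    then have "i \<le> j"
      unfolding i_def by (intro Min_le) auto
    with that show False
      by simp
  qed
  with i show ?thesis
    unfolding shortlex_less_def by (metis linorder_neq_iff)
qed

section \<open>The vector space of polynomials\<close>

lemma lookup_smult_poly [simp]:
  "Poly_Mapping.lookup (smult_poly c p) \<alpha> = c * Poly_Mapping.lookup p \<alpha>"
  by (simp add: Poly_Mapping.map.rep_eq when_def)

interpretation cpoly: vector_space smult_poly
  by unfold_locales (auto intro!: poly_mapping_eqI simp: lookup_add algebra_simps)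

lemma poly_eval_superset:
  assumes "finite A" "Poly_Mapping.keys p \<subseteq> A"
  shows "poly_eval p z = (\<Sum>\<alpha>\<in>A. Poly_Mapping.lookup p \<alpha> * monom_eval \<alpha> z)"
  unfolding poly_eval_def
  by (rule sum.mono_neutral_left) (use assms in \<open>auto simp: in_keys_iff\<close>)

lemma poly_eval_mono_poly [simp]: "poly_eval (mono_poly \<alpha>) z = monom_eval \<alpha> z"
  by (simp add: poly_eval_def)

lemma poly_eval_zero [simp]: "poly_eval 0 z = 0"
  by (simp add: poly_eval_def)

lemma poly_eval_smult: "poly_eval (smult_poly c p) z = c * poly_eval p z"
proof -
  have "poly_eval (smult_poly c p) z =
      (\<Sum>\<alpha>\<in>Poly_Mapping.keys p. Poly_Mapping.lookup (smult_poly c p) \<alpha> * monom_eval \<alpha> z)"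
    by (rule poly_eval_superset) (auto simp: in_keys_iff)
  then show ?thesis
    by (simp add: poly_eval_def sum_distrib_left mult.assoc)
qed

lemma poly_eval_add: "poly_eval (p + q) z = poly_eval p z + poly_eval q z"
proof -
  let ?A = "Poly_Mapping.keys p \<union> Poly_Mapping.keys q"
  have "poly_eval r z = (\<Sum>\<alpha>\<in>?A. Poly_Mapping.lookup r \<alpha> * monom_eval \<alpha> z)"
    if "r \<in> {p, q, p + q}" for r
    by (rule poly_eval_superset) (use that in \<open>auto simp: in_keys_iff lookup_add\<close>)
  then show ?thesis
    by (simp add: lookup_add sum.distrib distrib_right)
qed

lemma poly_eval_sum: "poly_eval (\<Sum>i\<in>A. f i) z = (\<Sum>i\<in>A. poly_eval (f i) z)"
  by (induction A rule: infinite_finite_induct) (auto simp: poly_eval_add)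

lemma cpoly_eq_sum_mono_poly:
  assumes "finite A" "Poly_Mapping.keys p \<subseteq> A"
  shows "p = (\<Sum>\<alpha>\<in>A. smult_poly (Poly_Mapping.lookup p \<alpha>) (mono_poly \<alpha>))"
proof (rule poly_mapping_eqI)
  fix \<gamma>
  have "Poly_Mapping.lookup (\<Sum>\<alpha>\<in>A. smult_poly (Poly_Mapping.lookup p \<alpha>) (mono_poly \<alpha>)) \<gamma> =
      (\<Sum>\<alpha>\<in>A. if \<alpha> = \<gamma> then Poly_Mapping.lookup p \<gamma> else 0)"
    unfolding lookup_sum by (intro sum.cong) (auto simp: lookup_single when_def)
  also have "\<dots> = Poly_Mapping.lookup p \<gamma>"
    using assms by (auto simp: sum.delta' in_keys_iff)
  finally show "Poly_Mapping.lookup p \<gamma> =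
      Poly_Mapping.lookup (\<Sum>\<alpha>\<in>A. smult_poly (Poly_Mapping.lookup p \<alpha>) (mono_poly \<alpha>)) \<gamma>" ..
qed

text \<open>
  The initial segments of the shortlex order below \<open>last_index n\<close> exhaust all multi-indices,
  since anything of length less than \<open>n\<close> precedes \<open>last_index n\<close>.
\<close>

lemma keys_subset_last_index:
  obtains n where "Poly_Mapping.keys (q :: 'd::{finite,linorder} cpoly) \<subseteq> {\<beta>. \<beta> \<preceq>\<^sub>s last_index n}"
proof -
  have "mlength \<alpha> < Suc (\<Sum>\<alpha>\<in>Poly_Mapping.keys q. mlength \<alpha>)" if "\<alpha> \<in> Poly_Mapping.keys q" for \<alpha>
    unfolding less_Suc_eq_le by (rule member_le_sum) (use that in auto)
  then show ?thesis
    by (intro that[of "Suc (\<Sum>\<alpha>\<in>Poly_Mapping.keys q. mlength \<alpha>)"])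
       (auto simp: shortlex_le_def shortlex_less_def mlength_last_index)
qed

lemma continuous_on_poly_eval: "continuous_on A (poly_eval p)"
  unfolding poly_eval_def monom_eval_def by (intro continuous_intros)

section \<open>The inner product of the measure\<close>

lemma cnj_poly_inner: "cnj (poly_inner \<mu> p q) = poly_inner \<mu> q p"
  unfolding poly_inner_def by (subst Bochner_Integration.integral_cnj[symmetric]) (simp add: mult.commute)

lemma poly_norm_power2: "(poly_norm \<mu> p)\<^sup>2 = (LINT \<zeta>|\<mu>. (cmod (poly_eval p \<zeta>))\<^sup>2)"
  by (simp add: poly_norm_def)

lemma poly_inner_self: "poly_inner \<mu> p p = complex_of_real ((poly_norm \<mu> p)\<^sup>2)"
  unfolding poly_norm_power2 poly_inner_def
  by (simp add: complex_norm_square del: of_real_power flip: integral_complex_of_real)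

locale nontrivial_sphere_measure = prob_space \<mu>
  for \<mu> :: "(complex ^ 'd::{finite,linorder}) measure" +
  assumes sets_sphere: "sets \<mu> = sets (restrict_space borel (sphere 0 1))"
    and nontrivial: "nontrivial \<mu>"
begin

lemma space_sphere: "space \<mu> = sphere 0 1"
  using sets_eq_imp_space_eq[OF sets_sphere] by (simp add: space_restrict_space)

lemma borel_measurable_poly_eval [measurable]: "poly_eval p \<in> borel_measurable \<mu>"
  by (subst measurable_cong_sets[OF sets_sphere refl])
     (intro borel_measurable_continuous_on_restrict continuous_on_poly_eval)

lemma poly_eval_bounded: "\<exists>B. \<forall>\<zeta>\<in>space \<mu>. cmod (poly_eval p \<zeta>) \<le> B"
proof -
  have "compact (poly_eval p ` sphere 0 1)"
    by (intro compact_continuous_image continuous_on_poly_eval compact_sphere)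
  from compact_imp_bounded[OF this] show ?thesis
    by (simp add: bounded_iff space_sphere)
qed

lemma integrable_poly_inner:
  "integrable \<mu> (\<lambda>\<zeta>. poly_eval p \<zeta> * cnj (poly_eval q \<zeta>))"
proof -
  obtain B C where "\<forall>\<zeta>\<in>space \<mu>. cmod (poly_eval p \<zeta>) \<le> B" "\<forall>\<zeta>\<in>space \<mu>. cmod (poly_eval q \<zeta>) \<le> C"
    using poly_eval_bounded by metis
  then have "AE \<zeta> in \<mu>. norm (poly_eval p \<zeta> * cnj (poly_eval q \<zeta>)) \<le> B * C"
    by (intro AE_I2) (auto simp: norm_mult intro!: mult_mono intro: order_trans[OF norm_ge_zero])
  moreover have "(\<lambda>\<zeta>. poly_eval p \<zeta> * cnj (poly_eval q \<zeta>)) \<in> borel_measurable \<mu>"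
    by (intro borel_measurable_times borel_measurable_poly_eval
        borel_measurable_continuous_on[OF continuous_on_cnj[OF continuous_on_id]])
  ultimately show ?thesis
    by (rule integrable_const_bound)
qed

lemma poly_inner_add_left: "poly_inner \<mu> (p + q) r = poly_inner \<mu> p r + poly_inner \<mu> q r"
  unfolding poly_inner_def poly_eval_add distrib_right
  by (intro Bochner_Integration.integral_add integrable_poly_inner)

lemma poly_inner_smult_left: "poly_inner \<mu> (smult_poly c p) q = c * poly_inner \<mu> p q"
  unfolding poly_inner_def poly_eval_smult mult.assoc by simp

lemma poly_inner_sum_left: "poly_inner \<mu> (\<Sum>i\<in>A. f i) q = (\<Sum>i\<in>A. poly_inner \<mu> (f i) q)"
proof (induction A rule: infinite_finite_induct)
  case (insert i A)
  then show ?case by (simp add: poly_inner_add_left)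
qed (simp_all add: poly_inner_def)

lemma poly_inner_diff_left: "poly_inner \<mu> (p - q) r = poly_inner \<mu> p r - poly_inner \<mu> q r"
  using poly_inner_add_left[of "p - q" q r] by simp

lemma poly_inner_smult_right: "poly_inner \<mu> p (smult_poly c q) = cnj c * poly_inner \<mu> p q"
  by (subst (1 2) cnj_poly_inner[symmetric]) (simp add: poly_inner_smult_left)

lemma poly_inner_sum_right: "poly_inner \<mu> p (\<Sum>i\<in>A. f i) = (\<Sum>i\<in>A. poly_inner \<mu> p (f i))"
  by (subst (1 2) cnj_poly_inner[symmetric]) (simp add: poly_inner_sum_left)

text \<open>A polynomial of norm zero vanishes almost everywhere on the sphere.\<close>

lemma poly_norm_eq_0D:
  assumes "poly_norm \<mu> p = 0"
  shows "poly_inner \<mu> p q = 0"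
proof -
  have "integrable \<mu> (\<lambda>\<zeta>. Re (poly_eval p \<zeta> * cnj (poly_eval p \<zeta>)))"
    by (intro integrable_Re integrable_poly_inner)
  then have "integrable \<mu> (\<lambda>\<zeta>. (cmod (poly_eval p \<zeta>))\<^sup>2)"
    unfolding cmod_power2 by (simp add: power2_eq_square)
  moreover have "(LINT \<zeta>|\<mu>. (cmod (poly_eval p \<zeta>))\<^sup>2) = 0"
    using assms by (simp flip: poly_norm_power2)
  ultimately have "AE \<zeta> in \<mu>. poly_eval p \<zeta> = 0"
    by (subst (asm) integral_nonneg_eq_0_iff_AE) auto
  then have "AE \<zeta> in \<mu>. poly_eval p \<zeta> * cnj (poly_eval q \<zeta>) = 0"
    by eventually_elim simp
  then show ?thesis
    unfolding poly_inner_def by (rule integral_eq_zero_AE)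
qed

text \<open>
  A polynomial of norm zero is orthogonal to every monomial, so its coefficient vector is
  annihilated by a Gram matrix, which is invertible.
\<close>

lemma poly_norm_eq_0_iff: "poly_norm \<mu> p = 0 \<longleftrightarrow> p = 0"
proof
  assume norm0: "poly_norm \<mu> p = 0"
  show "p = 0"
  proof (rule ccontr)
    assume "p \<noteq> 0"
    obtain n where n: "Poly_Mapping.keys p \<subseteq> {\<beta>. \<beta> \<preceq>\<^sub>s last_index n}"
      by (rule keys_subset_last_index)
    define I where "I = {\<beta> :: nat ^ 'd::{finite,linorder}. 0 \<preceq>\<^sub>s \<beta> \<and> \<beta> \<preceq>\<^sub>s last_index n}"
    let ?G = "\<lambda>\<alpha>' \<beta>'. LINT \<zeta>|\<mu>. monom_eval \<alpha>' \<zeta> * cnj (monom_eval \<beta>' \<zeta>)"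
    have G: "?G \<alpha> \<beta> = poly_inner \<mu> (mono_poly \<alpha>) (mono_poly \<beta>)" for \<alpha> \<beta>
      by (simp add: poly_inner_def)
    have I: "finite I" "Poly_Mapping.keys p \<subseteq> I"
      using n by (simp_all add: I_def zero_shortlex_le finite_shortlex_le)
    obtain B where B: "\<And>i j. i \<in> I \<Longrightarrow> j \<in> I \<Longrightarrow> (\<Sum>k\<in>I. ?G i k * B k j) = (if i = j then 1 else 0)"
      using nontrivial unfolding nontrivial_def invertible_on_def I_def by meson
    have annihilated: "(\<Sum>i\<in>I. Poly_Mapping.lookup p i * ?G i k) = 0" for k
    proof -
      have "(\<Sum>i\<in>I. Poly_Mapping.lookup p i * ?G i k) =
          poly_inner \<mu> (\<Sum>i\<in>I. smult_poly (Poly_Mapping.lookup p i) (mono_poly i)) (mono_poly k)"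
        by (simp only: G poly_inner_sum_left poly_inner_smult_left)
      also have "\<dots> = poly_inner \<mu> p (mono_poly k)"
        by (simp only: cpoly_eq_sum_mono_poly[OF I, symmetric])
      finally show ?thesis
        using poly_norm_eq_0D[OF norm0] by simp
    qed
    have "Poly_Mapping.lookup p j = 0" if "j \<in> I" for j
    proof -
      have "Poly_Mapping.lookup p j = (\<Sum>i\<in>I. if i = j then Poly_Mapping.lookup p i else 0)"
        using that I by simp
      also have "\<dots> = (\<Sum>i\<in>I. Poly_Mapping.lookup p i * (\<Sum>k\<in>I. ?G i k * B k j))"
        by (intro sum.cong) (auto simp: B that)
      also have "\<dots> = (\<Sum>i\<in>I. \<Sum>k\<in>I. Poly_Mapping.lookup p i * ?G i k * B k j)"
        by (simp add: sum_distrib_left mult.assoc)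
      also have "\<dots> = (\<Sum>k\<in>I. (\<Sum>i\<in>I. Poly_Mapping.lookup p i * ?G i k) * B k j)"
        by (subst sum.swap) (simp add: sum_distrib_right)
      also have "\<dots> = 0"
        by (simp add: annihilated)
      finally show ?thesis .
    qed
    then have "p = 0"
      using I by (intro poly_mapping_eqI) (auto simp: in_keys_iff subset_iff)
    with \<open>p \<noteq> 0\<close> show False
      by simp
  qed
next
  assume "p = 0"
  then show "poly_norm \<mu> p = 0"
    by (simp add: poly_norm_def)
qed

section \<open>Gram--Schmidt orthonormalization\<close>

lemma keys_orthog_poly: "\<gamma> \<in> Poly_Mapping.keys (orthog_poly \<mu> \<alpha>) \<Longrightarrow> \<gamma> \<preceq>\<^sub>s \<alpha>"
proof (induction \<alpha> arbitrary: \<gamma> rule: wf_induct_rule[OF wf_shortlex])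
  case (1 \<alpha>)
  show ?case
  proof (rule ccontr)
    assume \<gamma>: "\<not> \<gamma> \<preceq>\<^sub>s \<alpha>"
    have "Poly_Mapping.lookup (orthog_poly \<mu> \<beta>) \<gamma> = 0" if "\<beta> \<prec>\<^sub>s \<alpha>" for \<beta>
      using 1(1)[of \<beta> \<gamma>] that \<gamma> shortlex_le_less_trans[of \<gamma> \<beta> \<alpha>]
      by (auto simp: in_keys_iff shortlex_le_def)
    then have "Poly_Mapping.lookup (orthog_poly \<mu> \<alpha>) \<gamma> = 0"
      using \<gamma> by (subst orthog_poly.simps)
        (auto simp: lookup_minus lookup_sum lookup_single when_def shortlex_le_def)
    with 1(2) show False
      by (simp add: in_keys_iff)
  qed
qed

text \<open>
  The monomial that starts the step \<open>\<alpha>\<close> of Gram--Schmidt cannot be cancelled, because the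
  earlier polynomials only contain exponents before \<open>\<alpha>\<close>.
\<close>

lemma orthog_poly_nonzero: "orthog_poly \<mu> \<alpha> \<noteq> 0"
proof -
  have "Poly_Mapping.lookup (orthog_poly \<mu> \<beta>) \<alpha> = 0" if "\<beta> \<prec>\<^sub>s \<alpha>" for \<beta>
    using keys_orthog_poly[of \<alpha> \<beta>] that shortlex_le_less_trans shortlex_less_irrefl
    by (auto simp: in_keys_iff)
  then have "Poly_Mapping.lookup (orthog_poly \<mu> \<alpha>) \<alpha> = 1"
    by (subst orthog_poly.simps) (simp add: lookup_minus lookup_sum)
  then show ?thesis
    by auto
qed

lemma poly_norm_orthog_poly: "poly_norm \<mu> (orthog_poly \<mu> \<alpha>) \<noteq> 0"
  by (simp add: poly_norm_eq_0_iff orthog_poly_nonzero)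

text \<open>
  By induction the polynomials before \<open>\<alpha>\<close> are pairwise orthogonal, so in the inner product
  of the recursion with one of them only the term of that polynomial survives, and it cancels
  the contribution of the monomial.
\<close>

lemma orthog_poly_orthogonal_less:
  "\<beta> \<prec>\<^sub>s \<alpha> \<Longrightarrow> poly_inner \<mu> (orthog_poly \<mu> \<alpha>) (orthog_poly \<mu> \<beta>) = 0"
proof (induction \<alpha> arbitrary: \<beta> rule: wf_induct_rule[OF wf_shortlex])
  case (1 \<alpha>)
  let ?f = "orthog_poly \<mu>"
  let ?c = "\<lambda>\<gamma>. poly_inner \<mu> (mono_poly \<alpha>) (?f \<gamma>) / poly_inner \<mu> (?f \<gamma>) (?f \<gamma>)"
  have orth: "poly_inner \<mu> (?f \<gamma>) (?f \<beta>) = 0" if "\<gamma> \<prec>\<^sub>s \<alpha>" "\<gamma> \<noteq> \<beta>" for \<gamma>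
  proof (cases "\<beta> \<prec>\<^sub>s \<gamma>")
    case True
    then show ?thesis
      using 1(1)[of \<gamma> \<beta>] that by simp
  next
    case False
    then have "\<gamma> \<prec>\<^sub>s \<beta>"
      using shortlex_linear that by blast
    then have "poly_inner \<mu> (?f \<beta>) (?f \<gamma>) = 0"
      using 1 by simp
    then show ?thesis
      by (metis cnj_poly_inner complex_cnj_zero)
  qed
  have "poly_inner \<mu> (?f \<alpha>) (?f \<beta>) = poly_inner \<mu> (mono_poly \<alpha>) (?f \<beta>) -
      (\<Sum>\<gamma> | \<gamma> \<prec>\<^sub>s \<alpha>. ?c \<gamma> * poly_inner \<mu> (?f \<gamma>) (?f \<beta>))"
    by (subst orthog_poly.simps[of \<mu> \<alpha>])
       (simp only: poly_inner_diff_left poly_inner_sum_left poly_inner_smult_left)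
  also have "(\<Sum>\<gamma> | \<gamma> \<prec>\<^sub>s \<alpha>. ?c \<gamma> * poly_inner \<mu> (?f \<gamma>) (?f \<beta>)) =
      (\<Sum>\<gamma> | \<gamma> \<prec>\<^sub>s \<alpha>. if \<gamma> = \<beta> then ?c \<beta> * poly_inner \<mu> (?f \<beta>) (?f \<beta>) else 0)"
    by (intro sum.cong) (auto simp: orth)
  also have "\<dots> = poly_inner \<mu> (mono_poly \<alpha>) (?f \<beta>)"
    using 1(2) poly_norm_orthog_poly by (simp add: finite_shortlex_less poly_inner_self)
  finally show ?case
    by simp
qed

lemma orthog_poly_orthogonal:
  assumes "\<alpha> \<noteq> \<beta>"
  shows "poly_inner \<mu> (orthog_poly \<mu> \<alpha>) (orthog_poly \<mu> \<beta>) = 0"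
  using shortlex_linear[OF assms] orthog_poly_orthogonal_less cnj_poly_inner
  by (metis complex_cnj_zero)

lemma orthon_poly_orthonormal:
  "poly_inner \<mu> (orthon_poly \<mu> \<alpha>) (orthon_poly \<mu> \<beta>) = (if \<alpha> = \<beta> then 1 else 0)"
  using poly_norm_orthog_poly[of \<alpha>]
  by (auto simp: orthon_poly_def poly_inner_smult_left poly_inner_smult_right
      orthog_poly_orthogonal poly_inner_self power2_eq_square)

lemma inj_orthon_poly: "inj (orthon_poly \<mu>)"
  by (rule injI) (metis orthon_poly_orthonormal one_neq_zero)

lemma orthog_poly_in_span:
  assumes "\<alpha> \<in> A"
  shows "orthog_poly \<mu> \<alpha> \<in> cpoly.span (orthon_poly \<mu> ` A)"
proof -
  have "orthog_poly \<mu> \<alpha> =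
      smult_poly (complex_of_real (poly_norm \<mu> (orthog_poly \<mu> \<alpha>))) (orthon_poly \<mu> \<alpha>)"
    using poly_norm_orthog_poly[of \<alpha>] by (simp add: orthon_poly_def)
  then show ?thesis
    using assms by (metis cpoly.span_base cpoly.span_scale imageI)
qed

text \<open>The Gram--Schmidt recursion, solved for the monomial.\<close>

lemma mono_poly_in_span:
  assumes "{\<beta>. \<beta> \<preceq>\<^sub>s \<alpha>} \<subseteq> A"
  shows "mono_poly \<alpha> \<in> cpoly.span (orthon_poly \<mu> ` A)"
proof -
  let ?c = "\<lambda>\<beta>. poly_inner \<mu> (mono_poly \<alpha>) (orthog_poly \<mu> \<beta>)
    / poly_inner \<mu> (orthog_poly \<mu> \<beta>) (orthog_poly \<mu> \<beta>)"
  have "mono_poly \<alpha> = orthog_poly \<mu> \<alpha> +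
      (\<Sum>\<beta> | \<beta> \<prec>\<^sub>s \<alpha>. smult_poly (?c \<beta>) (orthog_poly \<mu> \<beta>))"
    by (subst orthog_poly.simps[of \<mu> \<alpha>]) simp
  also have "\<dots> \<in> cpoly.span (orthon_poly \<mu> ` A)"
    using assms
    by (intro cpoly.span_add cpoly.span_sum cpoly.span_scale orthog_poly_in_span)
       (auto simp: shortlex_le_def)
  finally show ?thesis .
qed

lemma orthon_poly_expansion:
  assumes "Poly_Mapping.keys p \<subseteq> {\<beta>. \<beta> \<preceq>\<^sub>s \<alpha>}"
  obtains c where "p = (\<Sum>\<beta> | \<beta> \<preceq>\<^sub>s \<alpha>. smult_poly (c \<beta>) (orthon_poly \<mu> \<beta>))"
proof -
  let ?A = "{\<beta>. \<beta> \<preceq>\<^sub>s \<alpha>}"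
  have "{\<gamma>. \<gamma> \<preceq>\<^sub>s \<beta>} \<subseteq> ?A" if "\<beta> \<preceq>\<^sub>s \<alpha>" for \<beta>
    using that by (auto simp: shortlex_le_def intro: shortlex_less_trans)
  then have "(\<Sum>\<beta>\<in>?A. smult_poly (Poly_Mapping.lookup p \<beta>) (mono_poly \<beta>))
      \<in> cpoly.span (orthon_poly \<mu> ` ?A)"
    by (intro cpoly.span_sum cpoly.span_scale mono_poly_in_span) auto
  then have "p \<in> cpoly.span (orthon_poly \<mu> ` ?A)"
    by (subst cpoly_eq_sum_mono_poly[OF finite_shortlex_le assms])
  then obtain u where "p = (\<Sum>v\<in>orthon_poly \<mu> ` ?A. smult_poly (u v) v)"
    by (subst (asm) cpoly.span_finite) (auto simp: finite_shortlex_le)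
  also have "\<dots> = (\<Sum>\<beta>\<in>?A. smult_poly (u (orthon_poly \<mu> \<beta>)) (orthon_poly \<mu> \<beta>))"
    by (subst sum.reindex) (auto intro: inj_on_subset[OF inj_orthon_poly])
  finally show ?thesis
    by (rule that)
qed

lemma poly_norm_orthon_sum:
  assumes "finite A"
  shows "(poly_norm \<mu> (\<Sum>\<alpha>\<in>A. smult_poly (c \<alpha>) (orthon_poly \<mu> \<alpha>)))\<^sup>2 = (\<Sum>\<alpha>\<in>A. (cmod (c \<alpha>))\<^sup>2)"
proof -
  have "complex_of_real ((poly_norm \<mu> (\<Sum>\<alpha>\<in>A. smult_poly (c \<alpha>) (orthon_poly \<mu> \<alpha>)))\<^sup>2) =
      (\<Sum>\<beta>\<in>A. \<Sum>\<alpha>\<in>A. cnj (c \<beta>) * (c \<alpha> * (if \<alpha> = \<beta> then 1 else 0)))"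
    by (simp only: poly_inner_self[symmetric] poly_inner_sum_left poly_inner_sum_right
        poly_inner_smult_left poly_inner_smult_right orthon_poly_orthonormal sum_distrib_left)
  also have "\<dots> = (\<Sum>\<alpha>\<in>A. c \<alpha> * cnj (c \<alpha>))"
    using assms by (simp add: if_distrib[of "(*) _"] mult.commute cong: if_cong)
  also have "\<dots> = complex_of_real (\<Sum>\<alpha>\<in>A. (cmod (c \<alpha>))\<^sup>2)"
    by (simp add: complex_norm_square del: of_real_power)
  finally show ?thesis
    by (simp only: of_real_eq_iff)
qed

section \<open>The extremal problem\<close>

text \<open>The reproducing kernel of \<open>V\<^sub>n\<close> on the diagonal.\<close>

definition kernel_diag where
  "kernel_diag n z = (\<Sum>\<alpha> | \<alpha> \<preceq>\<^sub>s last_index n. (cmod (poly_eval (orthon_poly \<mu> \<alpha>) z))\<^sup>2)"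

lemma christoffel_approx_eq: "christoffel_approx n \<mu> z = inverse (kernel_diag n z)"
  by (simp add: christoffel_approx_def kernel_diag_def zero_shortlex_le)

lemma kernel_diag_mono: "kernel_diag n z \<le> kernel_diag (Suc n) z"
proof -
  have "(last_index n :: nat ^ 'd::{finite,linorder}) \<prec>\<^sub>s last_index (Suc n)"
    by (simp add: shortlex_less_def mlength_last_index)
  then have "{\<alpha> :: nat ^ 'd::{finite,linorder}. \<alpha> \<preceq>\<^sub>s last_index n} \<subseteq> {\<alpha>. \<alpha> \<preceq>\<^sub>s last_index (Suc n)}"
    using shortlex_le_less_trans by (auto simp: shortlex_le_def[of _ "last_index (Suc n)"])
  then show ?thesis
    unfolding kernel_diag_def by (intro sum_mono2 finite_shortlex_le) auto
qed

text \<open>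
  Cauchy--Schwarz and Parseval, applied to the expansion of \<open>q\<close> in the orthonormal
  polynomials: the kernel bounds the evaluation functional.
\<close>

lemma kernel_diag_ge:
  assumes "Poly_Mapping.keys q \<subseteq> {\<beta>. \<beta> \<preceq>\<^sub>s last_index n}"
  shows "(cmod (poly_eval q z))\<^sup>2 \<le> (poly_norm \<mu> q)\<^sup>2 * kernel_diag n z"
proof -
  let ?A = "{\<beta> :: nat ^ 'd::{finite,linorder}. \<beta> \<preceq>\<^sub>s last_index n}"
  obtain c where q: "q = (\<Sum>\<beta>\<in>?A. smult_poly (c \<beta>) (orthon_poly \<mu> \<beta>))"
    using orthon_poly_expansion[OF assms] by blast
  have "cmod (poly_eval q z) \<le> (\<Sum>\<beta>\<in>?A. cmod (c \<beta>) * cmod (poly_eval (orthon_poly \<mu> \<beta>) z))"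
    unfolding q poly_eval_sum poly_eval_smult by (rule order_trans[OF norm_sum]) (simp add: norm_mult)
  then have "(cmod (poly_eval q z))\<^sup>2 \<le>
      (\<Sum>\<beta>\<in>?A. cmod (c \<beta>) * cmod (poly_eval (orthon_poly \<mu> \<beta>) z))\<^sup>2"
    by (rule power_mono) simp
  also have "\<dots> \<le> (\<Sum>\<beta>\<in>?A. (cmod (c \<beta>))\<^sup>2) * kernel_diag n z"
    unfolding kernel_diag_def by (rule Cauchy_Schwarz_ineq_sum)
  also have "(\<Sum>\<beta>\<in>?A. (cmod (c \<beta>))\<^sup>2) = (poly_norm \<mu> q)\<^sup>2"
    by (simp add: q poly_norm_orthon_sum finite_shortlex_le)
  finally show ?thesis .
qed

text \<open>The constant polynomial \<open>1\<close> has norm \<open>1\<close>, so the kernel is even at least \<open>1\<close>.\<close>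

lemma kernel_diag_pos: "0 < kernel_diag n z"
proof -
  have one: "poly_eval (mono_poly 0) w = 1" for w :: "complex ^ 'd::{finite,linorder}"
    by (simp only: poly_eval_mono_poly) (simp add: monom_eval_def)
  have "(cmod (poly_eval (mono_poly 0) z))\<^sup>2 \<le> (poly_norm \<mu> (mono_poly 0))\<^sup>2 * kernel_diag n z"
    by (rule kernel_diag_ge) (simp add: zero_shortlex_le)
  then have "1 \<le> kernel_diag n z"
    unfolding poly_norm_power2 one by (simp add: prob_space)
  then show ?thesis
    by simp
qed

lemma christoffel_approx_le:
  assumes "Poly_Mapping.keys q \<subseteq> {\<beta>. \<beta> \<preceq>\<^sub>s last_index n}" "poly_eval q z = 1"
  shows "christoffel_approx n \<mu> z \<le> (poly_norm \<mu> q)\<^sup>2"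
  using kernel_diag_ge[OF assms(1), of z] kernel_diag_pos[of n z] assms(2)
  by (simp add: christoffel_approx_eq field_simps)

text \<open>
  Equality in Cauchy--Schwarz requires coefficients proportional to the conjugates
  \<open>cnj (\<phi>\<^sub>\<beta>(z))\<close>; dividing by the kernel normalizes the value at \<open>z\<close> to \<open>1\<close>.
\<close>

lemma christoffel_approx_attained:
  obtains q where "poly_eval q z = 1" "(poly_norm \<mu> q)\<^sup>2 = christoffel_approx n \<mu> z"
proof -
  let ?A = "{\<beta> :: nat ^ 'd::{finite,linorder}. \<beta> \<preceq>\<^sub>s last_index n}"
  let ?K = "kernel_diag n z"
  define c where "c \<beta> = cnj (poly_eval (orthon_poly \<mu> \<beta>) z) / complex_of_real ?K" for \<beta>
  define q where "q = (\<Sum>\<beta>\<in>?A. smult_poly (c \<beta>) (orthon_poly \<mu> \<beta>))"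
  have K: "?K > 0"
    by (rule kernel_diag_pos)
  have "poly_eval q z = (\<Sum>\<beta>\<in>?A. complex_of_real ((cmod (poly_eval (orthon_poly \<mu> \<beta>) z))\<^sup>2) / complex_of_real ?K)"
    unfolding q_def poly_eval_sum poly_eval_smult c_def
    by (intro sum.cong refl) (simp add: complex_norm_square mult.commute del: of_real_power)
  also have "\<dots> = complex_of_real ?K / complex_of_real ?K"
    by (simp add: kernel_diag_def flip: sum_divide_distrib)
  finally have "poly_eval q z = 1"
    using K by simp
  moreover have "(poly_norm \<mu> q)\<^sup>2 = (\<Sum>\<beta>\<in>?A. (cmod (poly_eval (orthon_poly \<mu> \<beta>) z))\<^sup>2 / ?K\<^sup>2)"
    unfolding q_def by (subst poly_norm_orthon_sum)
      (simp_all add: finite_shortlex_le c_def norm_divide power_divide)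
  moreover have "\<dots> = christoffel_approx n \<mu> z"
    using K by (simp add: christoffel_approx_eq kernel_diag_def power2_eq_square field_simps
        flip: sum_divide_distrib)
  ultimately show ?thesis
    by (intro that) auto
qed

lemma christoffel_approx_tendsto:
  "(\<lambda>n. christoffel_approx n \<mu> z) \<longlonglongrightarrow>
     Inf {(poly_norm \<mu> q)\<^sup>2 | q. poly_eval q z = 1}"
proof -
  let ?E = "{(poly_norm \<mu> q)\<^sup>2 | q. poly_eval q z = 1}"
  have dec: "decseq (\<lambda>n. christoffel_approx n \<mu> z)"
    by (rule decseq_SucI)
       (simp add: christoffel_approx_eq kernel_diag_mono kernel_diag_pos)
  have attained: "christoffel_approx n \<mu> z \<in> ?E" for n
    using christoffel_approx_attained[of z n] by (smt (verit) mem_Collect_eq)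
  have bdd: "bdd_below ?E"
    by (rule bdd_belowI[of _ 0]) auto
  have bdd_approx: "bdd_below (range (\<lambda>n. christoffel_approx n \<mu> z))"
    using bdd by (rule bdd_below_mono) (use attained in blast)
  have "Inf ?E = (INF n. christoffel_approx n \<mu> z)"
  proof (rule antisym)
    show "Inf ?E \<le> (INF n. christoffel_approx n \<mu> z)"
      by (intro cINF_greatest cInf_lower attained bdd) simp
    show "(INF n. christoffel_approx n \<mu> z) \<le> Inf ?E"
    proof (rule cInf_greatest)
      show "?E \<noteq> {}"
        using attained by blast
      fix x assume "x \<in> ?E"
      then obtain q where q: "x = (poly_norm \<mu> q)\<^sup>2" "poly_eval q z = 1"
        by blast
      obtain n where n: "Poly_Mapping.keys q \<subseteq> {\<beta>. \<beta> \<preceq>\<^sub>s last_index n}"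
        by (rule keys_subset_last_index)
      have "(INF n. christoffel_approx n \<mu> z) \<le> christoffel_approx n \<mu> z"
        by (rule cINF_lower[OF bdd_approx]) simp
      also have "\<dots> \<le> x"
        unfolding q(1) using n q(2) by (rule christoffel_approx_le)
      finally show "(INF n. christoffel_approx n \<mu> z) \<le> x" .
    qed
  qed
  with LIMSEQ_decseq_INF[OF bdd_approx dec] show ?thesis
    by simp
qed

end

theorem lemma4p4:
  fixes \<mu> :: "(complex ^ 'd::{finite,linorder}) measure"
  assumes "prob_space \<mu>"
    and "sets \<mu> = sets (restrict_space borel (sphere 0 1))"
    and "nontrivial \<mu>"
  shows "\<forall>z. convergent (\<lambda>n. christoffel_approx n \<mu> z) \<and>
    christoffel \<mu> z =
      Inf {LINT \<zeta>|\<mu>. (cmod (poly_eval q \<zeta>))\<^sup>2 | q :: 'd cpoly. poly_eval q z = 1}"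
proof
  fix z
  interpret prob_space \<mu>
    by fact
  interpret nontrivial_sphere_measure \<mu>
    by unfold_locales fact+
  show "convergent (\<lambda>n. christoffel_approx n \<mu> z) \<and> christoffel \<mu> z =
      Inf {LINT \<zeta>|\<mu>. (cmod (poly_eval q \<zeta>))\<^sup>2 | q :: 'd cpoly. poly_eval q z = 1}"
    using christoffel_approx_tendsto[of z] unfolding poly_norm_power2
    by (auto simp: christoffel_def convergent_def dest: limI)
qed

end
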